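(* Let $n\ge1$. For distinct complex numbers $z_1,\dots,z_n,z_{n+1}$, $$\sum_{i=1}^{n}\frac{1}{z_i-z_{n+1}}\Big(\prod_{k=1,\,k\neq i}^{n}\frac{1}{z_k-z_i}\Big)=\prod_{i=1}^{n}\frac{1}{z_i-z_{n+1}}.$$ Equivalently, for any distinct complex numbers $z_1,\dots,z_n$, $$\sum_{i=1}^{n}\ \prod_{k=1,\,k\neq i}^{n}\frac{z_k-z}{z_k-z_i}=1\qquad\text{for all } z\in\mathbb{C}.$$
   Context: Empty products equal $1$. *)

theory Defs
  imports Complex_Main
begin

end

theory Submission
  imports Defs "HOL-Computational_Algebra.Polynomial"
begin

text \<open>The second identity says that the Lagrange basis polynomials for the nodes
  \<open>z\<^sub>1, \<dots>, z\<^sub>n\<close> sum to \<open>1\<close>. The \<open>i\<close>-th of them takes the value \<open>1\<close> at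
  \<open>z\<^sub>i\<close> and \<open>0\<close> at the other nodes, so the sum agrees with the constant \<open>1\<close> at \<open>n\<close> distinct
  points; its degree is at most \<open>n - 1\<close>, so it is that constant
  (\<open>sum_Lagrange_basis_eq_1\<close>). Dividing by \<open>\<Prod>i. (z\<^sub>i - w)\<close>, which cancels all factors
  \<open>z\<^sub>k - w\<close> of the \<open>i\<close>-th summand and leaves \<open>1 / (z\<^sub>i - w)\<close>, gives the first identity at
  \<open>w = z\<^sub>n\<^sub>+\<^sub>1\<close> (\<open>sum_partial_fractions_eq_prod\<close>).\<close>

text \<open>For \<open>I = {}\<close> the sum is \<open>0\<close>: the degree bound \<open>card I - 1\<close> lies below the number of
  nodes only if there is a node.\<close>

lemma sum_Lagrange_basis_eq_1:
  fixes z :: "'i \<Rightarrow> 'a :: field"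
  assumes "finite I" "I \<noteq> {}" "inj_on z I"
  shows "(\<Sum>i\<in>I. \<Prod>k\<in>I - {i}. (z k - w) / (z k - z i)) = 1"
proof -
  define L where "L i = (\<Prod>k\<in>I - {i}. smult (1 / (z k - z i)) [:z k, -1:])" for i
  have poly_L: "poly (L i) x = (\<Prod>k\<in>I - {i}. (z k - x) / (z k - z i))" for i x
    by (simp add: L_def poly_prod diff_divide_distrib)
  have card_pos: "card I > 0"
    using assms by (simp add: card_gt_0_iff)
  have "degree (L i) \<le> card I - 1" if "i \<in> I" for i
  proof -
    have "degree (L i) \<le> (\<Sum>k\<in>I - {i}. degree (smult (1 / (z k - z i)) [:z k, -1:]))"
      unfolding L_def by (rule order_trans[OF degree_prod_sum_le]) (use assms in \<open>simp_all add: o_def\<close>)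
    also have "\<dots> \<le> (\<Sum>k\<in>I - {i}. 1)"
      by (intro sum_mono) simp
    finally show ?thesis
      using that assms by simp
  qed
  hence "degree (\<Sum>i\<in>I. L i) \<le> card I - 1"
    using assms by (intro degree_sum_le) auto
  hence degree_less: "degree (\<Sum>i\<in>I. L i) < card (z ` I)"
    using card_pos assms by (simp add: card_image)
  have "poly (\<Sum>i\<in>I. L i) x = poly 1 x" if x: "x \<in> z ` I" for x
  proof -
    obtain j where j: "j \<in> I" "x = z j"
      using x by blast
    have "poly (L i) x = (if i = j then 1 else 0)" if "i \<in> I" for i
    proof (cases "i = j")
      case True
      have "(\<Prod>k\<in>I - {j}. (z k - z j) / (z k - z j)) = 1"
        using assms j by (intro prod.neutral) (auto simp: inj_on_eq_iff)
      thus ?thesis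
        using True j by (simp add: poly_L)
    next
      case False
      thus ?thesis
        using assms j by (auto simp: poly_L)
    qed
    thus ?thesis
      using assms j by (simp add: poly_sum)
  qed
  hence "(\<Sum>i\<in>I. L i) = 1"
    by (rule poly_eqI_degree) (use degree_less in auto)
  hence "poly (\<Sum>i\<in>I. L i) w = 1"
    by simp
  thus ?thesis
    by (simp add: poly_sum poly_L)
qed

lemma sum_partial_fractions_eq_prod:
  fixes z :: "'i \<Rightarrow> 'a :: field"
  assumes "finite I" "I \<noteq> {}" "inj_on z I" "w \<notin> z ` I"
  shows "(\<Sum>i\<in>I. 1 / (z i - w) * (\<Prod>k\<in>I - {i}. 1 / (z k - z i))) = (\<Prod>i\<in>I. 1 / (z i - w))"
proof -
  have "1 / (z i - w) * (\<Prod>k\<in>I - {i}. 1 / (z k - z i)) =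
          (\<Prod>k\<in>I. 1 / (z k - w)) * (\<Prod>k\<in>I - {i}. (z k - w) / (z k - z i))" if "i \<in> I" for i
  proof -
    have "(\<Prod>k\<in>I - {i}. 1 / (z k - z i)) =
            (\<Prod>k\<in>I - {i}. 1 / (z k - w) * ((z k - w) / (z k - z i)))"
      using assms by (intro prod.cong) auto
    thus ?thesis
      using that assms by (simp only: prod.distrib prod.remove[of I i] mult.assoc)
  qed
  hence "(\<Sum>i\<in>I. 1 / (z i - w) * (\<Prod>k\<in>I - {i}. 1 / (z k - z i))) =
           (\<Prod>k\<in>I. 1 / (z k - w)) * (\<Sum>i\<in>I. \<Prod>k\<in>I - {i}. (z k - w) / (z k - z i))"
    by (simp add: sum_distrib_left)
  thus ?thesis
    using assms by (simp add: sum_Lagrange_basis_eq_1)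
qed

theorem lemma1:
  fixes n :: nat
  assumes "n \<ge> 1"
  shows "(\<forall>z :: nat \<Rightarrow> complex. inj_on z {1..n+1} \<longrightarrow>
            (\<Sum>i=1..n. 1 / (z i - z (n+1)) * (\<Prod>k\<in>{1..n} - {i}. 1 / (z k - z i)))
              = (\<Prod>i=1..n. 1 / (z i - z (n+1))))
       \<and> (\<forall>z :: nat \<Rightarrow> complex. inj_on z {1..n} \<longrightarrow>
            (\<forall>w :: complex. (\<Sum>i=1..n. \<Prod>k\<in>{1..n} - {i}. (z k - w) / (z k - z i)) = 1))"
proof (intro conjI allI impI)
  fix z :: "nat \<Rightarrow> complex"
  assume inj: "inj_on z {1..n+1}"
  have "inj_on z {1..n}"
    by (rule inj_on_subset[OF inj]) auto
  moreover have "z (n+1) \<notin> z ` {1..n}"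
  proof
    assume "z (n+1) \<in> z ` {1..n}"
    then obtain i where "i \<in> {1..n}" "z (n+1) = z i"
      by blast
    with inj_onD[OF inj, of "n+1" i] show False
      by simp
  qed
  ultimately show "(\<Sum>i=1..n. 1 / (z i - z (n+1)) * (\<Prod>k\<in>{1..n} - {i}. 1 / (z k - z i)))
      = (\<Prod>i=1..n. 1 / (z i - z (n+1)))"
    using assms by (intro sum_partial_fractions_eq_prod) auto
next
  fix z :: "nat \<Rightarrow> complex" and w :: complex
  assume "inj_on z {1..n}"
  thus "(\<Sum>i=1..n. \<Prod>k\<in>{1..n} - {i}. (z k - w) / (z k - z i)) = 1"
    using assms by (intro sum_Lagrange_basis_eq_1) auto
qed

end
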